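(* Let $A,B,C,D$ be functions of $\lambda\in\mathbb C^n$ (two-space matrices) satisfying the zero-weight conditions $[h_i\otimes 1,B_{12}]=0$, $[1\otimes h_i,C_{12}]=0$, $[h_i\otimes 1+1\otimes h_i,D_{12}]=0$ for all $i$, with $C_{12}=B_{21}$, and satisfying the consistency equations $$A_{12}A_{13}A_{23}=A_{23}A_{13}A_{12},$$ $$A_{12}C_{13}C_{23}=C_{23}C_{13}A_{12}(h_3),$$ $$D_{12}B_{13}B_{23}(h_1)=B_{23}B_{13}(h_2)D_{12},$$ $$D_{12}(h_3)D_{13}D_{23}(h_1)=D_{23}D_{13}(h_2)D_{12}.$$ Let $d_{ij}(\lambda)$ be the coefficient of $e_{ii}\otimes e_{jj}$ in $D_{12}(\lambda)$. Assume $d_{ij}(\lambda)\neq 0$ for all $i,j\in\{1,\dots,n\}$ and all $\lambda$, and that $B(\lambda)$ is invertible for all $\lambda$. Then there exist an invertible one-space dynamical matrix $b(\lambda)$ and a two-space matrix $R_{12}(\lambda)$ such that $$A_{12}=b_1^{-1}b_2^{-1}\,R_{12}\,b_1b_2,\qquad B_{12}=b_2^{-1}\,b_2(h_1),\qquad C_{12}=b_1^{-1}\,b_1(h_2),$$ where $R$ is non-dynamical, i.e. $R_{12}(\lambda+\gamma\epsilon_i)=R_{12}(\lambda)$ for all $i$ and all $\lambda$, and satisfies the Yang–Baxter equation $R_{12}R_{13}R_{23}=R_{23}R_{13}R_{12}$.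
   Context: Setting. Fix $n\ge 1$, $V=\mathbb C^n$ with matrix units $e_{ij}$; $\mathfrak h$ is the Cartan subalgebra of $gl(n)$ (diagonal matrices) with basis $h_i=e_{ii}$; $\gamma\in\mathbb C$, $\gamma\ne0$; $\lambda=(\lambda_1,\dots,\lambda_n)\in\mathbb C^n$ are the dynamical variables and $\epsilon_i$ is the $i$-th standard basis vector of $\mathbb C^n$. The auxiliary space is either $V$ (finite-dimensional case) or $V\otimes\mathbb C[[u]]$ (spectral-parameter case). A one-space matrix takes values in $\mathrm{End}(V)$ (respectively $\mathrm{End}(V)\otimes\mathbb C[[u]]$), a two-space matrix in $\mathrm{End}(V)\otimes\mathrm{End}(V)$ (respectively tensored with $\mathbb C[[u_1,u_2]]$). In the spectral-parameter case, space number $j$ carries the parameter $u_j$; in that case $B_{12}$ depends on $u_2$ only, i.e. $B_{12}=\sum_i e_{ii}\otimes b_i(\lambda)$ with $b_i(\lambda)\in\mathrm{End}(V)\otimes\mathbb C[[u]]$. Subscripts indicate the tensor factors (spaces) in which a matrix acts. "Dynamical matrix" means a matrix-valued function of $\lambda$; no regularity in $\lambda$ is imposed. The argument $\lambda$ is often omitted. Dynamical shift. If $f(\lambda)$ does not act in space $a$, then $f(h_a)$ denotes $f(\lambda+\gamma h_a):=\sum_{i=1}^n f(\lambda+\gamma\epsilon_i)\,(e_{ii})_a$, where $(e_{ii})_a$ acts in space $a$. For example $b_2(h_1)=\sum_i e_{ii}\otimes b(\lambda+\gamma\epsilon_i)$. *)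

theory Defs
  imports "HOL-Analysis.Analysis"
begin

section \<open>Matrices acting in one, two and three copies of V\<close>

text \<open>
  V has the basis indexed by a finite type \<open>'n\<close>; its tensor powers have the bases indexed by
  \<open>'n \<times> 'n\<close> and \<open>'n \<times> 'n \<times> 'n\<close>. The entry \<open>M $ (i, j) $ (k, l)\<close> is the coefficient of
  the tensor product of the matrix units \<open>e\<^sub>i\<^sub>k\<close> and \<open>e\<^sub>j\<^sub>l\<close>. The entries lie in a commutative ring
  \<open>'a\<close>: the complex numbers or a ring of formal power series.
\<close>

type_synonym ('a, 'n) op1 = "'a ^ 'n ^ 'n"
type_synonym ('a, 'n) op2 = "'a ^ ('n \<times> 'n) ^ ('n \<times> 'n)"
type_synonym ('a, 'n) op3 = "'a ^ ('n \<times> 'n \<times> 'n) ^ ('n \<times> 'n \<times> 'n)"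

definition munit :: "'n::finite \<Rightarrow> 'n \<Rightarrow> ('a::comm_ring_1, 'n) op1" where
  "munit i j = (\<chi> k l. if k = i \<and> l = j then 1 else 0)"

definition kron :: "'a::comm_ring_1 ^ 'm ^ 'm \<Rightarrow> 'a ^ 'k ^ 'k \<Rightarrow> 'a ^ ('m::finite \<times> 'k::finite) ^ ('m \<times> 'k)"
    (infixr \<open>\<otimes>\<^sub>k\<close> 75) where
  "X \<otimes>\<^sub>k Y = (\<chi> p q. X $ fst p $ fst q * Y $ snd p $ snd q)"

definition commutator :: "'a::comm_ring_1 ^ 'm ^ 'm \<Rightarrow> 'a ^ 'm ^ 'm \<Rightarrow> 'a ^ 'm::finite ^ 'm" where
  "commutator X Y = X ** Y - Y ** X"

definition leg1 :: "('a::comm_ring_1, 'n::finite) op1 \<Rightarrow> ('a, 'n) op2" where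
  "leg1 X = X \<otimes>\<^sub>k mat 1"

definition leg2 :: "('a::comm_ring_1, 'n::finite) op1 \<Rightarrow> ('a, 'n) op2" where
  "leg2 X = mat 1 \<otimes>\<^sub>k X"

definition leg12 :: "('a::comm_ring_1, 'n::finite) op2 \<Rightarrow> ('a, 'n) op3" where
  "leg12 M = (\<chi> p q. case (p, q) of ((i, j, k), (i', j', k')) \<Rightarrow>
     if k = k' then M $ (i, j) $ (i', j') else 0)"

definition leg13 :: "('a::comm_ring_1, 'n::finite) op2 \<Rightarrow> ('a, 'n) op3" where
  "leg13 M = (\<chi> p q. case (p, q) of ((i, j, k), (i', j', k')) \<Rightarrow>
     if j = j' then M $ (i, k) $ (i', k') else 0)"

definition leg23 :: "('a::comm_ring_1, 'n::finite) op2 \<Rightarrow> ('a, 'n) op3" where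
  "leg23 M = (\<chi> p q. case (p, q) of ((i, j, k), (i', j', k')) \<Rightarrow>
     if i = i' then M $ (j, k) $ (j', k') else 0)"

definition leg21 :: "('a::comm_ring_1, 'n::finite) op2 \<Rightarrow> ('a, 'n) op2" where
  "leg21 M = (\<chi> p q. case (p, q) of ((i, j), (i', j')) \<Rightarrow> M $ (j, i) $ (j', i'))"


section \<open>Spectral parameters\<close>

text \<open>
  Power series in several variables are iterated, the last variable being the outermost one:
  \<open>fps_nth (fps_nth F m) k\<close> is the coefficient of \<open>u\<^sub>1\<^sup>k u\<^sub>2\<^sup>m\<close> in \<open>F :: complex fps fps\<close>, and similarly
  for three variables. Each \<open>ser\<close> map below substitutes the indicated variables, and
  each \<open>sleg\<close> map places a matrix in the indicated spaces together with their parameters.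
\<close>

definition fps_map :: "('a \<Rightarrow> 'b) \<Rightarrow> 'a fps \<Rightarrow> 'b fps" where
  "fps_map f F = Abs_fps (\<lambda>m. f (fps_nth F m))"

definition ser1 :: "complex fps \<Rightarrow> complex fps fps" where
  "ser1 F = fps_const F"

definition ser2 :: "complex fps \<Rightarrow> complex fps fps" where
  "ser2 F = fps_map fps_const F"

definition ser21 :: "complex fps fps \<Rightarrow> complex fps fps" where
  "ser21 F = Abs_fps (\<lambda>m. Abs_fps (\<lambda>k. fps_nth (fps_nth F k) m))"

definition ser12 :: "complex fps fps \<Rightarrow> complex fps fps fps" where
  "ser12 F = fps_const F"

definition ser13 :: "complex fps fps \<Rightarrow> complex fps fps fps" where
  "ser13 F = fps_map fps_const F"

definition ser23 :: "complex fps fps \<Rightarrow> complex fps fps fps" where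
  "ser23 F = fps_map (fps_map fps_const) F"

definition sleg1 :: "(complex fps, 'n::finite) op1 \<Rightarrow> (complex fps fps, 'n) op2" where
  "sleg1 X = leg1 (map_matrix ser1 X)"

definition sleg2 :: "(complex fps, 'n::finite) op1 \<Rightarrow> (complex fps fps, 'n) op2" where
  "sleg2 X = leg2 (map_matrix ser2 X)"

definition sleg21 :: "(complex fps fps, 'n::finite) op2 \<Rightarrow> (complex fps fps, 'n) op2" where
  "sleg21 M = leg21 (map_matrix ser21 M)"

definition sleg12 :: "(complex fps fps, 'n::finite) op2 \<Rightarrow> (complex fps fps fps, 'n) op3" where
  "sleg12 M = leg12 (map_matrix ser12 M)"

definition sleg13 :: "(complex fps fps, 'n::finite) op2 \<Rightarrow> (complex fps fps fps, 'n) op3" where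
  "sleg13 M = leg13 (map_matrix ser13 M)"

definition sleg23 :: "(complex fps fps, 'n::finite) op2 \<Rightarrow> (complex fps fps fps, 'n) op3" where
  "sleg23 M = leg23 (map_matrix ser23 M)"


section \<open>Dynamical shifts\<close>

definition translate :: "complex \<Rightarrow> complex ^ 'n::finite \<Rightarrow> 'n \<Rightarrow> complex ^ 'n" where
  "translate \<gamma> x i = x + \<gamma> *s axis i 1"

text \<open>
  In \<open>dshift \<gamma> E f x\<close> the family \<open>E\<close> gives the action of the diagonal matrix units
  in the space \<open>a\<close> of \<open>f(h\<^sub>a)\<close>, and \<open>f\<close> is already placed in the other spaces.
\<close>

definition dshift :: "complex \<Rightarrow> ('n::finite \<Rightarrow> 'a::comm_ring_1 ^ 'm ^ 'm) \<Rightarrow>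
    (complex ^ 'n \<Rightarrow> 'a ^ 'm ^ 'm) \<Rightarrow> complex ^ 'n \<Rightarrow> 'a ^ 'm::finite ^ 'm" where
  "dshift \<gamma> E f x = (\<Sum>i\<in>UNIV. f (translate \<gamma> x i) ** E i)"

definition two_h1 :: "'n::finite \<Rightarrow> ('a::comm_ring_1, 'n) op2" where
  "two_h1 i = munit i i \<otimes>\<^sub>k mat 1"

definition two_h2 :: "'n::finite \<Rightarrow> ('a::comm_ring_1, 'n) op2" where
  "two_h2 i = mat 1 \<otimes>\<^sub>k munit i i"

definition three_h1 :: "'n::finite \<Rightarrow> ('a::comm_ring_1, 'n) op3" where
  "three_h1 i = munit i i \<otimes>\<^sub>k mat 1 \<otimes>\<^sub>k mat 1"

definition three_h2 :: "'n::finite \<Rightarrow> ('a::comm_ring_1, 'n) op3" where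
  "three_h2 i = mat 1 \<otimes>\<^sub>k munit i i \<otimes>\<^sub>k mat 1"

definition three_h3 :: "'n::finite \<Rightarrow> ('a::comm_ring_1, 'n) op3" where
  "three_h3 i = mat 1 \<otimes>\<^sub>k mat 1 \<otimes>\<^sub>k munit i i"


section \<open>Zero weight conditions and consistency equations\<close>

definition zero_weight :: "(complex ^ 'n \<Rightarrow> ('a::comm_ring_1, 'n::finite) op2) \<Rightarrow>
    (complex ^ 'n \<Rightarrow> ('a, 'n) op2) \<Rightarrow> (complex ^ 'n \<Rightarrow> ('a, 'n) op2) \<Rightarrow> bool" where
  "zero_weight B C D \<longleftrightarrow> (\<forall>x i.
     commutator (two_h1 i) (B x) = 0 \<and>
     commutator (two_h2 i) (C x) = 0 \<and>
     commutator (two_h1 i + two_h2 i) (D x) = 0)"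

text \<open>
  The maps \<open>L12\<close>, \<open>L13\<close>, \<open>L23\<close> place a two-space matrix in three spaces, with or without
  spectral parameters.
\<close>

definition yang_baxter :: "(('a, 'n) op2 \<Rightarrow> ('b::comm_ring_1, 'n::finite) op3) \<Rightarrow>
    (('a, 'n) op2 \<Rightarrow> ('b, 'n) op3) \<Rightarrow> (('a, 'n) op2 \<Rightarrow> ('b, 'n) op3) \<Rightarrow>
    ('a, 'n) op2 \<Rightarrow> bool" where
  "yang_baxter L12 L13 L23 R \<longleftrightarrow> L12 R ** L13 R ** L23 R = L23 R ** L13 R ** L12 R"

definition consistency_equations :: "complex \<Rightarrow>
    (('a, 'n) op2 \<Rightarrow> ('b::comm_ring_1, 'n::finite) op3) \<Rightarrow>
    (('a, 'n) op2 \<Rightarrow> ('b, 'n) op3) \<Rightarrow> (('a, 'n) op2 \<Rightarrow> ('b, 'n) op3) \<Rightarrow>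
    (complex ^ 'n \<Rightarrow> ('a, 'n) op2) \<Rightarrow> (complex ^ 'n \<Rightarrow> ('a, 'n) op2) \<Rightarrow>
    (complex ^ 'n \<Rightarrow> ('a, 'n) op2) \<Rightarrow> (complex ^ 'n \<Rightarrow> ('a, 'n) op2) \<Rightarrow> bool" where
  "consistency_equations \<gamma> L12 L13 L23 A B C D \<longleftrightarrow> (\<forall>x.
     yang_baxter L12 L13 L23 (A x) \<and>
     L12 (A x) ** L13 (C x) ** L23 (C x) =
       L23 (C x) ** L13 (C x) ** dshift \<gamma> three_h3 (\<lambda>y. L12 (A y)) x \<and>
     L12 (D x) ** L13 (B x) ** dshift \<gamma> three_h1 (\<lambda>y. L23 (B y)) x =
       L23 (B x) ** dshift \<gamma> three_h2 (\<lambda>y. L13 (B y)) x ** L12 (D x) \<and>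
     dshift \<gamma> three_h3 (\<lambda>y. L12 (D y)) x ** L13 (D x) ** dshift \<gamma> three_h1 (\<lambda>y. L23 (D y)) x =
       L23 (D x) ** dshift \<gamma> three_h2 (\<lambda>y. L13 (D y)) x ** L12 (D x))"

end

theory Submission
  imports Defs
begin

text \<open>
  Write \<open>B = \<Sum>\<^sub>i e\<^sub>i\<^sub>i \<otimes> \<beta>\<^sub>i\<close>. The coefficient of \<open>e\<^sub>i\<^sub>i \<otimes> e\<^sub>j\<^sub>j\<close> in the equation for \<open>D, B, B\<close> is, after
  cancelling \<open>d\<^sub>i\<^sub>j\<close>, the zero curvature condition
  \<open>\<beta>\<^sub>i(\<lambda>) \<beta>\<^sub>j(\<lambda> + \<gamma>\<epsilon>\<^sub>i) = \<beta>\<^sub>j(\<lambda>) \<beta>\<^sub>i(\<lambda> + \<gamma>\<epsilon>\<^sub>j)\<close>. The lattice \<open>\<gamma>\<int>\<^sup>n\<close> acts freely on the values of \<open>\<lambda>\<close>, so the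
  connection is trivial: \<open>b(\<lambda> + \<gamma>\<epsilon>\<^sub>i) = b(\<lambda>) \<beta>\<^sub>i(\<lambda>)\<close> for some invertible \<open>b\<close>. The equation for \<open>A, C, C\<close>
  says that \<open>\<beta>\<^sub>k \<otimes> \<beta>\<^sub>k\<close> intertwines \<open>A(\<lambda>)\<close> and \<open>A(\<lambda> + \<gamma>\<epsilon>\<^sub>k)\<close>, so the conjugate \<open>R\<close> of \<open>A\<close> by \<open>b \<otimes> b\<close> is periodic.
\<close>

section \<open>Placing matrices in tensor factors\<close>

lemma sum_UNIV_pair:
  "(\<Sum>p\<in>UNIV. f p) = (\<Sum>i\<in>UNIV. \<Sum>j\<in>UNIV. f (i :: 'a::finite, j :: 'b::finite))"
  by (simp add: sum.cartesian_product flip: UNIV_Times_UNIV)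

text \<open>Right multiplication by \<open>E i\<close> keeps exactly the columns \<open>q\<close>
  with \<open>\<phi> q = i\<close>, so a shift translates each column in its own direction. The
  choice of \<open>\<phi>\<close> selects the shifting space.\<close>

lemma dshift_diagonal:
  fixes E :: "'n::finite \<Rightarrow> 'a::comm_ring_1 ^ 'm ^ 'm::finite"
  assumes "\<And>i. E i = (\<chi> p q. if p = q \<and> \<phi> q = i then 1 else 0)"
  shows "dshift \<gamma> E f x $ p $ q = f (translate \<gamma> x (\<phi> q)) $ p $ q"
proof -
  have "(M ** E i) $ p $ q = (if i = \<phi> q then M $ p $ q else 0)" for M i
    by (auto simp: assms matrix_matrix_mult_def if_distrib cong: if_cong)
  then show ?thesis
    by (simp add: dshift_def)
qed

lemma two_h1_diagonal: "two_h1 i = (\<chi> p q. if p = q \<and> fst q = i then 1 else 0)"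
  by (auto simp: two_h1_def kron_def munit_def mat_def vec_eq_iff)

lemma two_h2_diagonal: "two_h2 i = (\<chi> p q. if p = q \<and> snd q = i then 1 else 0)"
  by (auto simp: two_h2_def kron_def munit_def mat_def vec_eq_iff)

lemma three_h1_diagonal: "three_h1 i = (\<chi> p q. if p = q \<and> fst q = i then 1 else 0)"
  by (auto simp: three_h1_def kron_def munit_def mat_def vec_eq_iff)

lemma three_h2_diagonal: "three_h2 i = (\<chi> p q. if p = q \<and> fst (snd q) = i then 1 else 0)"
  by (auto simp: three_h2_def kron_def munit_def mat_def vec_eq_iff)

lemma three_h3_diagonal: "three_h3 i = (\<chi> p q. if p = q \<and> snd (snd q) = i then 1 else 0)"
  by (auto simp: three_h3_def kron_def munit_def mat_def vec_eq_iff)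

lemmas dshift_two_h1 = dshift_diagonal[OF two_h1_diagonal]
  and dshift_two_h2 = dshift_diagonal[OF two_h2_diagonal]
  and dshift_three_h1 = dshift_diagonal[OF three_h1_diagonal]
  and dshift_three_h2 = dshift_diagonal[OF three_h2_diagonal]
  and dshift_three_h3 = dshift_diagonal[OF three_h3_diagonal]

lemma leg_entry:
  "leg1 X $ (i, j) $ (i', j') = (if j = j' then X $ i $ i' else 0)"
  "leg2 X $ (i, j) $ (i', j') = (if i = i' then X $ j $ j' else 0)"
  "leg21 M $ (i, j) $ (i', j') = M $ (j, i) $ (j', i')"
  "leg12 M $ (i, j, k) $ (i', j', k') = (if k = k' then M $ (i, j) $ (i', j') else 0)"
  "leg13 M $ (i, j, k) $ (i', j', k') = (if j = j' then M $ (i, k) $ (i', k') else 0)"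
  "leg23 M $ (i, j, k) $ (i', j', k') = (if i = i' then M $ (j, k) $ (j', k') else 0)"
  by (simp_all add: leg1_def leg2_def leg12_def leg13_def leg23_def leg21_def kron_def mat_def)

lemma matrix_mult_entry: "(X ** Y) $ p $ q = (\<Sum>r\<in>UNIV. X $ p $ r * Y $ r $ q)"
  by (simp add: matrix_matrix_mult_def)

lemma mult_if_zero:
  "(if P then a else 0) * (if Q then b else 0) = (if P then if Q then a * b else 0 else (0::'a::comm_ring_1))"
  by simp

lemma sum_if_zero: "(\<Sum>c\<in>A. if P then f c else 0) = (if P then \<Sum>c\<in>A. f c else 0)"
  by simp

lemmas leg_mult_simps = vec_eq_iff leg_entry matrix_mult_entry sum_UNIV_pair mult_if_zero sum_if_zero

lemma leg_mult:
  "leg1 (X ** Y) = leg1 X ** leg1 Y"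
  "leg2 (X ** Y) = leg2 X ** leg2 Y"
  "leg12 (M ** N) = leg12 M ** leg12 N"
  "leg13 (M ** N) = leg13 M ** leg13 N"
  "leg23 (M ** N) = leg23 M ** leg23 N"
  by (simp_all add: leg_mult_simps)

lemma leg_mat1:
  "leg1 (mat 1) = mat 1" "leg2 (mat 1) = mat 1"
  "leg12 (mat 1) = mat 1" "leg13 (mat 1) = mat 1" "leg23 (mat 1) = mat 1"
  by (auto simp: vec_eq_iff leg_entry mat_def)

lemma leg_commute:
  "leg2 Y ** leg1 X = leg1 X ** leg2 Y"
  "leg12 M ** leg23 (leg2 X) = leg23 (leg2 X) ** leg12 M"
  "leg13 M ** leg12 (leg2 X) = leg12 (leg2 X) ** leg13 M"
  "leg23 M ** leg12 (leg1 X) = leg12 (leg1 X) ** leg23 M"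
  by (simp_all add: leg_mult_simps mult_delta_left mult_delta_right mult.commute)

text \<open>Used as rewrite rules, these leave \<open>leg12 (leg1 X)\<close>,
  \<open>leg12 (leg2 X)\<close> and \<open>leg23 (leg2 X)\<close> as the normal forms of
  \<open>X\<close> in spaces 1, 2 and 3.\<close>

lemma leg_leg:
  "leg13 (leg1 X) = leg12 (leg1 X)"
  "leg23 (leg1 X) = leg12 (leg2 X)"
  "leg13 (leg2 X) = leg23 (leg2 X)"
  by (simp_all add: vec_eq_iff leg_entry)

section \<open>Inverses and intertwiners over a commutative ring\<close>

lemma matrix_inv_right: "invertible X \<Longrightarrow> X ** matrix_inv X = mat 1"
  and matrix_inv_left: "invertible X \<Longrightarrow> matrix_inv X ** X = mat 1"
  for X :: "'a::comm_ring_1 ^ 'm ^ 'm"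
  unfolding invertible_def matrix_inv_def by (metis (mono_tags, lifting) someI_ex)+

lemma invertible_matrix_inv: "invertible X \<Longrightarrow> invertible (matrix_inv X)"
  for X :: "'a::comm_ring_1 ^ 'm ^ 'm"
  using matrix_inv_right matrix_inv_left invertible_def by blast

lemma matrix_mult_right_cancel:
  fixes X Y Z :: "'a::comm_ring_1 ^ 'm ^ 'm"
  assumes "invertible Z" and "X ** Z = Y ** Z"
  shows "X = Y"
proof -
  have "X ** (Z ** matrix_inv Z) = Y ** (Z ** matrix_inv Z)"
    by (simp only: matrix_mul_assoc assms)
  then show ?thesis
    by (simp add: matrix_inv_right \<open>invertible Z\<close>)
qed

lemma intertwine:
  fixes M N T Z :: "'a::comm_ring_1 ^ 'm::finite ^ 'm"
  assumes "N ** T = T ** M"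
  shows "M ** Z = Z ** M \<Longrightarrow> N ** (T ** Z) = (T ** Z) ** M"
    and "N' ** T = T ** M' \<Longrightarrow> (N ** N') ** T = T ** (M ** M')"
proof -
  assume "M ** Z = Z ** M"
  have "N ** (T ** Z) = T ** (M ** Z)"
    by (simp only: matrix_mul_assoc assms)
  then show "N ** (T ** Z) = (T ** Z) ** M"
    by (simp only: \<open>M ** Z = Z ** M\<close> matrix_mul_assoc)
next
  assume "N' ** T = T ** M'"
  have "(N ** N') ** T = N ** (N' ** T)"
    by (simp only: matrix_mul_assoc)
  also have "\<dots> = (N ** T) ** M'"
    by (simp only: \<open>N' ** T = T ** M'\<close> matrix_mul_assoc)
  finally show "(N ** N') ** T = T ** (M ** M')"
    by (simp only: assms matrix_mul_assoc)
qed

lemma invertible_leg: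
  "invertible X \<Longrightarrow> invertible (leg1 X)"
  "invertible X \<Longrightarrow> invertible (leg2 X)"
  "invertible M \<Longrightarrow> invertible (leg12 M)"
  "invertible M \<Longrightarrow> invertible (leg23 M)"
  unfolding invertible_def by (metis leg_mult leg_mat1)+

section \<open>Flat sections\<close>

primrec forward_transport :: "(int \<Rightarrow> 'a::comm_ring_1 ^ 'm ^ 'm) \<Rightarrow> nat \<Rightarrow> 'a ^ 'm ^ 'm" where
  "forward_transport f 0 = mat 1"
| "forward_transport f (Suc k) = forward_transport f k ** f (int k)"

text \<open>The product \<open>f(-1)^{-1} ... f(-k)^{-1}\<close>, obtained by running the recursion
  \<open>t (m + 1) = t m ** f m\<close> downwards from \<open>t 0 = mat 1\<close>.\<close>

primrec backward_transport :: "(int \<Rightarrow> 'a::comm_ring_1 ^ 'm ^ 'm) \<Rightarrow> nat \<Rightarrow> 'a ^ 'm ^ 'm" where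
  "backward_transport f 0 = mat 1"
| "backward_transport f (Suc k) = backward_transport f k ** matrix_inv (f (- int k - 1))"

definition transport :: "(int \<Rightarrow> 'a::comm_ring_1 ^ 'm ^ 'm) \<Rightarrow> int \<Rightarrow> 'a ^ 'm ^ 'm" where
  "transport f m = (if m \<ge> 0 then forward_transport f (nat m) else backward_transport f (nat (- m)))"

lemma transport_step:
  assumes "\<And>l. invertible (f l)"
  shows "transport f (m + 1) = transport f m ** f m"
proof (cases "m \<ge> 0")
  case True
  then show ?thesis
    by (simp add: transport_def nat_add_distrib)
next
  case False
  define k where "k = nat (- m - 1)"
  have m: "m = - int k - 1"
    using False by (simp add: k_def)
  \<comment> \<open>For \<open>k = 0\<close> the point \<open>m + 1 = 0\<close> lies in the forward
    branch; both branches give the empty product there.\<close>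
  have "transport f (m + 1) = backward_transport f k"
    by (cases "k = 0") (simp_all add: transport_def m)
  moreover have "transport f m = backward_transport f (Suc k)"
    by (simp add: transport_def m nat_add_distrib)
  ultimately show ?thesis
    by (simp add: m assms matrix_inv_left flip: matrix_mul_assoc)
qed

lemma transport_invertible:
  assumes "\<And>l. invertible (f l)"
  shows "invertible (transport f m)"
proof -
  have 1: "invertible (mat 1 :: 'a ^ 'm ^ 'm)"
    unfolding invertible_def by (metis matrix_mul_rid)
  have "invertible (forward_transport f k)" "invertible (backward_transport f k)" for k
    by (induction k) (simp_all add: 1 assms invertible_matrix_inv invertible_mult)
  then show ?thesis
    by (simp add: transport_def)
qed

lemma translate_nth: "translate \<gamma> x i $ j = x $ j + (if i = j then \<gamma> else 0)"
  by (simp add: translate_def axis_def)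

lemma translate_commute: "translate \<gamma> (translate \<gamma> x i) j = translate \<gamma> (translate \<gamma> x j) i"
  by (simp add: translate_def algebra_simps)

text \<open>As \<gamma> is nonzero, each orbit of the shift in direction \<open>j\<close> is a copy
  of the integers, and transport along it solves the recursion. The last conclusion drives the
  induction over directions: a shift in direction \<open>i\<close> moves the orbit to a parallel one
  on which \<open>f\<close> takes the same values.\<close>

lemma flat_section_in_direction:
  fixes f :: "complex ^ 'n::finite \<Rightarrow> 'a::comm_ring_1 ^ 'm ^ 'm"
  assumes "\<gamma> \<noteq> 0" and inv: "\<And>x. invertible (f x)"
  shows "\<exists>c :: complex ^ 'n \<Rightarrow> 'a ^ 'm ^ 'm. (\<forall>x. invertible (c x)) \<and>
    (\<forall>x. c (translate \<gamma> x j) = c x ** f x) \<and>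
    (\<forall>i x. i \<noteq> j \<longrightarrow> (\<forall>y. f (translate \<gamma> y i) = f y) \<longrightarrow> c (translate \<gamma> x i) = c x)"
proof -
  \<comment> \<open>Points with \<open>Re (x\<^sub>j / \<gamma>) \<in> [0, 1)\<close> represent the orbits of the shift in direction \<open>j\<close>.\<close>
  define m where "m x = \<lfloor>Re (x $ j / \<gamma>)\<rfloor>" for x :: "complex ^ 'n"
  \<comment> \<open>\<open>line x l\<close> is the point of the orbit of \<open>x\<close> at which
    \<open>m\<close> equals \<open>l\<close>. It depends on the orbit only, so \<open>x\<close> and
    its shift in direction \<open>j\<close> use the same factors.\<close>
  define line where "line x l = x + (of_int (l - m x) * \<gamma>) *s axis j 1" for x l
  define c where "c x = transport (\<lambda>l. f (line x l)) (m x)" for x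
  have c_inv: "invertible (c x)" for x
    by (simp add: c_def inv transport_invertible)
  have m_j: "m (translate \<gamma> x j) = m x + 1" for x
    using \<open>\<gamma> \<noteq> 0\<close> by (simp add: m_def translate_nth add_divide_distrib)
  have "line (translate \<gamma> x j) l = line x l" for x l
    unfolding line_def m_j by (simp add: translate_def vec_eq_iff axis_def algebra_simps)
  moreover have "line x (m x) = x" for x
    by (simp add: line_def)
  ultimately have c_j: "c (translate \<gamma> x j) = c x ** f x" for x
    by (simp add: c_def m_j inv transport_step)
  have c_i: "c (translate \<gamma> x i) = c x" if "i \<noteq> j" and f: "\<forall>y. f (translate \<gamma> y i) = f y" for i x
  proof -
    have m_i: "m (translate \<gamma> x i) = m x"
      using \<open>i \<noteq> j\<close> by (simp add: m_def translate_nth)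
    have "line (translate \<gamma> x i) l = translate \<gamma> (line x l) i" for l
      unfolding line_def m_i by (simp add: translate_def algebra_simps)
    then show ?thesis
      by (simp add: c_def m_i f)
  qed
  show ?thesis
    using c_inv c_j c_i by blast
qed

text \<open>
  Directions are treated one at a time: a section \<open>b\<close> that is flat in the directions of \<open>S\<close> gauges
  \<open>\<beta> j\<close> to a function that is periodic in these directions, so that the transport along a further
  direction \<open>j\<close> does not disturb them.
\<close>

lemma flat_section_on:
  fixes \<beta> :: "'n::finite \<Rightarrow> complex ^ 'n \<Rightarrow> 'a::comm_ring_1 ^ 'm ^ 'm"
  assumes "\<gamma> \<noteq> 0" and inv: "\<And>i x. invertible (\<beta> i x)"
    and flat: "\<And>i j x. \<beta> i x ** \<beta> j (translate \<gamma> x i) = \<beta> j x ** \<beta> i (translate \<gamma> x j)"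
  shows "\<exists>b :: complex ^ 'n \<Rightarrow> 'a ^ 'm ^ 'm. (\<forall>x. invertible (b x)) \<and>
    (\<forall>x. \<forall>i\<in>S. b (translate \<gamma> x i) = b x ** \<beta> i x)"
    (is "\<exists>b. ?flat S b")
proof (induction S rule: finite_induct[OF finite])
  case 1
  have "invertible (mat 1 :: 'a ^ 'm ^ 'm)"
    unfolding invertible_def by (metis matrix_mul_rid)
  then show ?case
    by (intro exI[of _ "\<lambda>x. mat 1"]) simp
next
  case (2 j S)
  then obtain b :: "complex ^ 'n \<Rightarrow> 'a ^ 'm ^ 'm" where b_inv: "\<And>x. invertible (b x)"
    and b: "\<And>x i. i \<in> S \<Longrightarrow> b (translate \<gamma> x i) = b x ** \<beta> i x"
    by blast
  define f where "f x = b x ** \<beta> j x ** matrix_inv (b (translate \<gamma> x j))" for x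
  have f_b: "f x ** b (translate \<gamma> x j) = b x ** \<beta> j x" for x
    by (simp add: f_def b_inv matrix_inv_left flip: matrix_mul_assoc)
  have "invertible (f x)" for x
    by (simp add: f_def b_inv inv invertible_matrix_inv invertible_mult)
  from flat_section_in_direction[where f = f and j = j, OF \<open>\<gamma> \<noteq> 0\<close> this]
  obtain c :: "complex ^ 'n \<Rightarrow> 'a ^ 'm ^ 'm" where
    c_inv: "\<And>x. invertible (c x)"
    and c_j: "\<And>x. c (translate \<gamma> x j) = c x ** f x"
    and c_i: "\<And>i x. i \<noteq> j \<Longrightarrow> \<forall>y. f (translate \<gamma> y i) = f y \<Longrightarrow> c (translate \<gamma> x i) = c x"
    by blast
  \<comment> \<open>Flatness enters here: multiplied by \<open>b\<close> at the doubly shifted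
    point, both sides become \<open>b x\<close> followed by the transport along two sides of a
    square, taken in the two orders.\<close>
  have f_i: "f (translate \<gamma> x i) = f x" if "i \<in> S" for i x
  proof (rule matrix_mult_right_cancel[OF b_inv])
    have "f (translate \<gamma> x i) ** b (translate \<gamma> (translate \<gamma> x i) j)
        = b x ** (\<beta> i x ** \<beta> j (translate \<gamma> x i))"
      by (simp only: f_b b[OF that] matrix_mul_assoc)
    also have "\<dots> = b x ** \<beta> j x ** \<beta> i (translate \<gamma> x j)"
      by (simp only: flat[of i x j] matrix_mul_assoc)
    also have "\<dots> = f x ** b (translate \<gamma> (translate \<gamma> x j) i)"
      by (simp only: b[OF that] matrix_mul_assoc f_b)
    also have "translate \<gamma> (translate \<gamma> x j) i = translate \<gamma> (translate \<gamma> x i) j"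
      by (rule translate_commute)
    finally show "f (translate \<gamma> x i) ** b (translate \<gamma> (translate \<gamma> x i) j)
      = f x ** b (translate \<gamma> (translate \<gamma> x i) j)" .
  qed
  \<comment> \<open>The new section is \<open>c x ** b x\<close>: in direction \<open>j\<close> the
    factor \<open>f\<close> gained by \<open>c\<close> corrects \<open>b\<close>; in the other
    directions \<open>f\<close> is periodic, hence so is \<open>c\<close>.\<close>
  have "c (translate \<gamma> x i) ** b (translate \<gamma> x i) = c x ** b x ** \<beta> i x" if "i \<in> insert j S" for x i
  proof (cases "i = j")
    case True
    then show ?thesis
      by (simp add: c_j f_b flip: matrix_mul_assoc)
  next
    case False
    with that have "i \<in> S"
      by simp
    then show ?thesis
      using False by (simp add: c_i f_i b matrix_mul_assoc)
  qed
  then show ?case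
    by (intro exI[of _ "\<lambda>x. c x ** b x"]) (simp add: b_inv c_inv invertible_mult)
qed

lemma flat_section:
  fixes \<beta> :: "'n::finite \<Rightarrow> complex ^ 'n \<Rightarrow> 'a::comm_ring_1 ^ 'm ^ 'm"
  assumes "\<gamma> \<noteq> 0" and "\<And>i x. invertible (\<beta> i x)"
    and "\<And>i j x. \<beta> i x ** \<beta> j (translate \<gamma> x i) = \<beta> j x ** \<beta> i (translate \<gamma> x j)"
  obtains b :: "complex ^ 'n \<Rightarrow> 'a ^ 'm ^ 'm"
  where "\<And>x. invertible (b x)" and "\<And>x i. b (translate \<gamma> x i) = b x ** \<beta> i x"
proof -
  have "\<exists>b :: complex ^ 'n \<Rightarrow> 'a ^ 'm ^ 'm. (\<forall>x. invertible (b x)) \<and> (\<forall>x. \<forall>i\<in>UNIV. b (translate \<gamma> x i) = b x ** \<beta> i x)"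
    by (intro flat_section_on assms)
  then show ?thesis
    using that by blast
qed

section \<open>Block-diagonal matrices in three spaces\<close>

text \<open>The factors \<open>B\<close> in the equation for D, B, B are diagonal in spaces 1 and 2
  with blocks acting in space 3. Every factor in the equation for A, C, C is diagonal in space 3,
  which is the shape of \<open>diag3\<close>.\<close>

definition diag12 :: "('n::finite \<Rightarrow> 'n \<Rightarrow> ('a::comm_ring_1, 'n) op1) \<Rightarrow> ('a, 'n) op3" where
  "diag12 F = (\<chi> p q. case (p, q) of ((i, j, k), (i', j', k')) \<Rightarrow>
     if i = i' then if j = j' then F i j $ k $ k' else 0 else 0)"

definition diag3 :: "('n::finite \<Rightarrow> ('a::comm_ring_1, 'n) op2) \<Rightarrow> ('a, 'n) op3" where
  "diag3 F = (\<chi> p q. case (p, q) of ((i, j, k), (i', j', k')) \<Rightarrow>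
     if k = k' then F k $ (i, j) $ (i', j') else 0)"

lemma diag_entry:
  "diag12 F $ (i, j, k) $ (i', j', k') = (if i = i' then if j = j' then F i j $ k $ k' else 0 else 0)"
  "diag3 G $ (i, j, k) $ (i', j', k') = (if k = k' then G k $ (i, j) $ (i', j') else 0)"
  by (simp_all add: diag12_def diag3_def)

lemma diag_mult:
  "diag12 F ** diag12 F' = diag12 (\<lambda>i j. F i j ** F' i j)"
  "diag3 G ** diag3 G' = diag3 (\<lambda>k. G k ** G' k)"
  by (simp_all add: leg_mult_simps diag_entry)

lemma mult_diag12_entry:
  "(M ** diag12 F) $ (i, j, k) $ (i, j, k') = (\<Sum>c\<in>UNIV. M $ (i, j, k) $ (i, j, c) * F i j $ c $ k')"
  by (simp add: matrix_mult_entry sum_UNIV_pair diag_entry mult_delta_right sum_if_zero)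

lemma diag12_mult_entry:
  "(diag12 F ** M) $ (i, j, k) $ (i, j, k') = (\<Sum>c\<in>UNIV. F i j $ k $ c * M $ (i, j, c) $ (i, j, k'))"
  by (simp add: matrix_mult_entry sum_UNIV_pair diag_entry mult_delta_left sum_if_zero)

text \<open>Since \<open>diag12 F\<close> does not mix blocks, only the scalar diagonal entry of
  \<open>M\<close> survives on the block \<open>(i, j)\<close>, on either side. This is how D is
  cancelled.\<close>

lemma leg12_diag12_entries:
  "(leg12 M ** diag12 F) $ (i, j, k) $ (i, j, k') = M $ (i, j) $ (i, j) * F i j $ k $ k'"
  "(diag12 F ** leg12 M) $ (i, j, k) $ (i, j, k') = M $ (i, j) $ (i, j) * F i j $ k $ k'"
  by (simp_all add: mult_diag12_entry diag12_mult_entry leg_entry mult_delta_left mult_delta_right mult.commute)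

lemma diag3_eq_iff: "diag3 F = diag3 G \<longleftrightarrow> (\<forall>k. F k = G k)"
  by (auto simp: vec_eq_iff diag_entry)

section \<open>Changes of the coefficient ring\<close>

definition ring_morphism :: "('a::comm_ring_1 \<Rightarrow> 'b::comm_ring_1) \<Rightarrow> bool" where
  "ring_morphism h \<longleftrightarrow> h 0 = 0 \<and> h 1 = 1 \<and> (\<forall>x y. h (x + y) = h x + h y) \<and> (\<forall>x y. h (x * y) = h x * h y)"

lemma ring_morphism_sum: "ring_morphism h \<Longrightarrow> h (sum f A) = (\<Sum>x\<in>A. h (f x))"
  by (induction A rule: infinite_finite_induct) (auto simp: ring_morphism_def)

lemma map_matrix_leg:
  assumes "ring_morphism h"
  shows "map_matrix h (leg1 X) = leg1 (map_matrix h X)"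
    and "map_matrix h (leg2 X) = leg2 (map_matrix h X)"
  using assms by (auto simp: ring_morphism_def vec_eq_iff leg_entry)

lemma map_matrix_mat1: "ring_morphism h \<Longrightarrow> map_matrix h (mat 1) = mat 1"
  by (simp add: ring_morphism_def vec_eq_iff mat_def)

lemma map_matrix_mult:
  fixes X :: "'a::comm_ring_1 ^ 'k::finite ^ 'm::finite" and Y :: "'a ^ 'l::finite ^ 'k"
  assumes "ring_morphism h"
  shows "map_matrix h (X ** Y) = map_matrix h X ** map_matrix h Y"
  using assms by (simp add: vec_eq_iff matrix_mult_entry ring_morphism_sum ring_morphism_def)

lemma invertible_map_matrix:
  "invertible X \<Longrightarrow> ring_morphism h \<Longrightarrow> invertible (map_matrix h X)"
  for X :: "'a::comm_ring_1 ^ 'm::finite ^ 'm"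
  unfolding invertible_def by (metis map_matrix_mult map_matrix_mat1)

lemma map_matrix_eq_iff: "inj h \<Longrightarrow> map_matrix h X = map_matrix h Y \<longleftrightarrow> X = Y"
  by (simp add: vec_eq_iff inj_eq)

text \<open>
  The maps \<open>p1\<close>, \<open>p2\<close> send a series in one variable to the same series in \<open>u\<^sub>1\<close>, respectively \<open>u\<^sub>2\<close>;
  \<open>q12\<close>, \<open>q13\<close>, \<open>q23\<close> send a series in two variables to the series in the indicated pair of variables;
  \<open>e\<close> evaluates at \<open>u\<^sub>1 = 0\<close>. Without spectral parameters all of them are the identity.
\<close>

locale parameter_maps =
  fixes p1 p2 :: "'a::comm_ring_1 \<Rightarrow> 'b::idom" and swap :: "'b \<Rightarrow> 'b" and e :: "'b \<Rightarrow> 'a"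
    and q12 q13 q23 :: "'b \<Rightarrow> 'c::idom"
  assumes p1: "ring_morphism p1" and p2: "ring_morphism p2" and e: "ring_morphism e"
    and q12: "ring_morphism q12" and q13: "ring_morphism q13" and q23: "ring_morphism q23"
    and swap_0: "swap 0 = 0" and swap_p2: "swap (p2 a) = p1 a" and e_p2: "e (p2 a) = a"
    and q13_p1: "q13 (p1 a) = q12 (p1 a)" and q23_p1: "q23 (p1 a) = q12 (p2 a)"
    and q13_p2: "q13 (p2 a) = q23 (p2 a)"
    and inj_q12: "inj q12" and inj_q23: "inj q23"
begin

abbreviation lg1 :: "('a, 'n::finite) op1 \<Rightarrow> ('b, 'n) op2" where
  "lg1 X \<equiv> leg1 (map_matrix p1 X)"

abbreviation lg2 :: "('a, 'n::finite) op1 \<Rightarrow> ('b, 'n) op2" where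
  "lg2 X \<equiv> leg2 (map_matrix p2 X)"

abbreviation lg12 :: "('b, 'n::finite) op2 \<Rightarrow> ('c, 'n) op3" where
  "lg12 M \<equiv> leg12 (map_matrix q12 M)"

abbreviation lg13 :: "('b, 'n::finite) op2 \<Rightarrow> ('c, 'n) op3" where
  "lg13 M \<equiv> leg13 (map_matrix q13 M)"

abbreviation lg23 :: "('b, 'n::finite) op2 \<Rightarrow> ('c, 'n) op3" where
  "lg23 M \<equiv> leg23 (map_matrix q23 M)"

lemma lg_mult:
  "lg1 (X ** Y) = lg1 X ** lg1 Y"
  "lg2 (X ** Y) = lg2 X ** lg2 Y"
  "lg12 (M ** N) = lg12 M ** lg12 N"
  "lg13 (M ** N) = lg13 M ** lg13 N"
  "lg23 (M ** N) = lg23 M ** lg23 N"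
  by (simp_all add: map_matrix_mult p1 p2 q12 q13 q23 leg_mult)

lemma lg_mat1: "lg1 (mat 1) = mat 1" "lg2 (mat 1) = mat 1"
  by (simp_all add: map_matrix_mat1 p1 p2 leg_mat1)

text \<open>The parameter travels with the space, so a matrix in space \<open>j\<close> is a series
  in \<open>u_j\<close> whichever pair of spaces it was placed through.\<close>

lemma lg_leg:
  "lg13 (lg1 X) = lg12 (lg1 X)"
  "lg23 (lg1 X) = lg12 (lg2 X)"
  "lg13 (lg2 X) = lg23 (lg2 X)"
proof -
  have "map_matrix q13 (map_matrix p1 X) = map_matrix q12 (map_matrix p1 X)"
    "map_matrix q23 (map_matrix p1 X) = map_matrix q12 (map_matrix p2 X)"
    "map_matrix q13 (map_matrix p2 X) = map_matrix q23 (map_matrix p2 X)"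
    by (simp_all add: vec_eq_iff q13_p1 q23_p1 q13_p2)
  then show "lg13 (lg1 X) = lg12 (lg1 X)" "lg23 (lg1 X) = lg12 (lg2 X)" "lg13 (lg2 X) = lg23 (lg2 X)"
    by (simp_all add: map_matrix_leg q12 q13 q23 leg_leg)
qed

lemma lg_commute:
  "lg12 M ** lg23 (lg2 X) = lg23 (lg2 X) ** lg12 M"
  "lg13 M ** lg12 (lg2 X) = lg12 (lg2 X) ** lg13 M"
  "lg23 M ** lg12 (lg1 X) = lg12 (lg1 X) ** lg23 M"
  by (simp_all add: map_matrix_leg q12 q13 q23 leg_commute)

text \<open>The product \<open>T\<close> of the copies of \<open>X\<close> in all three spaces
  intertwines each placement of \<open>M\<close> with that of \<open>N\<close>, because the copy in
  the third space commutes with it. Both sides of the equation are thus conjugated by the same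
  invertible \<open>T\<close>.\<close>

lemma yang_baxter_conjugate:
  assumes YB: "yang_baxter lg12 lg13 lg23 M" and "invertible X"
    and N: "N ** (lg1 X ** lg2 X) = (lg1 X ** lg2 X) ** M"
  shows "yang_baxter lg12 lg13 lg23 N"
proof -
  define x1 where "x1 = lg12 (lg1 X)"
  define x2 where "x2 = lg12 (lg2 X)"
  define x3 where "x3 = lg23 (lg2 X)"
  define T where "T = x1 ** x2 ** x3"
  have com: "x2 ** x1 = x1 ** x2" "x3 ** x1 = x1 ** x3" "x3 ** x2 = x2 ** x3"
    using lg_commute(1)[of "lg1 X" X] lg_commute(1)[of "lg2 X" X]
    by (simp_all add: x1_def x2_def x3_def leg_commute(1) flip: lg_mult)
  \<comment> \<open>Each regrouping puts the copy of \<open>X\<close> that commutes with the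
    placement last, as \<open>intertwine(1)\<close> requires.\<close>
  have T23: "T = x2 ** x3 ** x1" and T13: "T = x1 ** x3 ** x2"
    by (simp_all add: T_def com flip: matrix_mul_assoc) (simp add: com matrix_mul_assoc)
  have "lg12 N ** (x1 ** x2) = (x1 ** x2) ** lg12 M"
    and "lg13 N ** (x1 ** x3) = (x1 ** x3) ** lg13 M"
    and "lg23 N ** (x2 ** x3) = (x2 ** x3) ** lg23 M"
    using N[THEN arg_cong, of lg12] N[THEN arg_cong, of lg13] N[THEN arg_cong, of lg23]
    by (simp_all only: lg_mult lg_leg x1_def x2_def x3_def)
  note N_legs = this
  have N12: "lg12 N ** T = T ** lg12 M"
    unfolding T_def by (intro intertwine(1) N_legs) (simp only: lg_commute x3_def)
  have N13: "lg13 N ** T = T ** lg13 M"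
    unfolding T13 by (intro intertwine(1) N_legs) (simp only: lg_commute x2_def)
  have N23: "lg23 N ** T = T ** lg23 M"
    unfolding T23 by (intro intertwine(1) N_legs) (simp only: lg_commute x1_def)
  have "(lg12 N ** lg13 N ** lg23 N) ** T = T ** (lg12 M ** lg13 M ** lg23 M)"
    by (intro intertwine(2) N12 N13 N23)
  moreover have "(lg23 N ** lg13 N ** lg12 N) ** T = T ** (lg23 M ** lg13 M ** lg12 M)"
    by (intro intertwine(2) N12 N13 N23)
  moreover have "invertible T"
    unfolding T_def x1_def x2_def x3_def
    by (intro invertible_mult invertible_leg invertible_map_matrix p1 p2 q12 q23 \<open>invertible X\<close>)
  ultimately show ?thesis
    using YB matrix_mult_right_cancel unfolding yang_baxter_def by metis
qed

lemma map_matrix_e_p2: "map_matrix e (map_matrix p2 X) = X"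
  by (simp add: vec_eq_iff e_p2)

text \<open>A diagonal block of the inverse of \<open>B\<close> inverts \<open>\<beta> i\<close>,
  but may depend on both parameters; evaluating at \<open>u_1 = 0\<close> by \<open>e\<close> gives
  an inverse in \<open>u_2\<close> alone.\<close>

lemma invertible_diagonal_block:
  assumes B: "\<And>i j i' j'. B $ (i, j) $ (i', j') = (if i = i' then p2 (\<beta> i $ j $ j') else 0)"
    and "invertible (B :: ('b, 'n::finite) op2)"
  shows "invertible (\<beta> i :: ('a, 'n) op1)"
proof -
  obtain B' where "B ** B' = mat 1" "B' ** B = mat 1"
    using \<open>invertible B\<close> unfolding invertible_def by blast
  define X where "X = (\<chi> j l. B' $ (i, j) $ (i, l))"
  have "(B ** B') $ (i, j) $ (i, l) = (map_matrix p2 (\<beta> i) ** X) $ j $ l"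
    "(B' ** B) $ (i, j) $ (i, l) = (X ** map_matrix p2 (\<beta> i)) $ j $ l" for j l
    by (simp_all add: matrix_mult_entry sum_UNIV_pair B X_def mult_delta_left mult_delta_right sum_if_zero)
  then have "map_matrix p2 (\<beta> i) ** X = mat 1" "X ** map_matrix p2 (\<beta> i) = mat 1"
    by (simp_all add: \<open>B ** B' = mat 1\<close> \<open>B' ** B = mat 1\<close> vec_eq_iff mat_def)
  then have "map_matrix e (map_matrix p2 (\<beta> i) ** X) = mat 1" "map_matrix e (X ** map_matrix p2 (\<beta> i)) = mat 1"
    by (simp_all add: map_matrix_mat1 e)
  then show ?thesis
    unfolding invertible_def by (auto simp: map_matrix_mult e map_matrix_e_p2)
qed

text \<open>The common form of both cases. The assumed block form of \<open>B\<close> combines zero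
  weight with dependence on \<open>u_2\<close> alone.\<close>

lemma vertex_form:
  fixes A B C D :: "complex ^ 'n::finite \<Rightarrow> ('b, 'n) op2"
  assumes "\<gamma> \<noteq> 0"
    and B: "\<And>x i j i' j'. B x $ (i, j) $ (i', j') = (if i = i' then p2 (\<beta> i x $ j $ j') else 0)"
    and C: "\<And>x. C x = leg21 (map_matrix swap (B x))"
    and eqs: "consistency_equations \<gamma> lg12 lg13 lg23 A B C D"
    and D: "\<And>x i j. D x $ (i, j) $ (i, j) \<noteq> 0"
    and B_inv: "\<And>x. invertible (B x)"
  shows "\<exists>(b :: complex ^ 'n \<Rightarrow> ('a, 'n) op1) (R :: complex ^ 'n \<Rightarrow> ('b, 'n) op2).
           (\<forall>x. invertible (b x)) \<and>
           (\<forall>x. A x = lg1 (matrix_inv (b x)) ** lg2 (matrix_inv (b x)) ** R x **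
                        lg1 (b x) ** lg2 (b x)) \<and>
           (\<forall>x. B x = lg2 (matrix_inv (b x)) ** dshift \<gamma> two_h1 (\<lambda>y. lg2 (b y)) x) \<and>
           (\<forall>x. C x = lg1 (matrix_inv (b x)) ** dshift \<gamma> two_h2 (\<lambda>y. lg1 (b y)) x) \<and>
           (\<forall>x i. R (translate \<gamma> x i) = R x) \<and>
           (\<forall>x. yang_baxter lg12 lg13 lg23 (R x))"
proof -
  have C_entry: "C x $ (i, j) $ (i', j') = (if j = j' then p1 (\<beta> j x $ i $ i') else 0)" for x i j i' j'
    by (simp add: C leg_entry B swap_p2 swap_0)
  have \<beta>_inv: "invertible (\<beta> i x)" for i x
    by (rule invertible_diagonal_block[where \<beta> = "\<lambda>i. \<beta> i x", OF B B_inv])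
  have flat: "\<beta> i x ** \<beta> j (translate \<gamma> x i) = \<beta> j x ** \<beta> i (translate \<gamma> x j)" for i j x
  proof -
    \<comment> \<open>All factors \<open>B\<close> in the equation for D, B, B act in space 3, so a
      single substitution of \<open>u_3\<close> serves for them.\<close>
    define r3 where "r3 a = q23 (p2 a)" for a
    have r3: "ring_morphism r3"
      using p2 q23 by (simp add: ring_morphism_def r3_def)
    have "inj r3"
      using inj_q23 e_p2 unfolding r3_def inj_def by metis
    have zero: "q13 0 = 0" "q23 0 = 0" "q12 0 = 0"
      using q13 q23 q12 by (simp_all add: ring_morphism_def)
    have diag: "lg13 (B x) = diag12 (\<lambda>i j. map_matrix r3 (\<beta> i x))"
      "lg23 (B x) = diag12 (\<lambda>i j. map_matrix r3 (\<beta> j x))"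
      "dshift \<gamma> three_h1 (\<lambda>y. lg23 (B y)) x = diag12 (\<lambda>i j. map_matrix r3 (\<beta> j (translate \<gamma> x i)))"
      "dshift \<gamma> three_h2 (\<lambda>y. lg13 (B y)) x = diag12 (\<lambda>i j. map_matrix r3 (\<beta> i (translate \<gamma> x j)))"
      by (simp_all add: vec_eq_iff leg_entry B diag_entry dshift_three_h1 dshift_three_h2 r3_def q13_p2 zero)
    have "lg12 (D x) ** lg13 (B x) ** dshift \<gamma> three_h1 (\<lambda>y. lg23 (B y)) x =
        lg23 (B x) ** dshift \<gamma> three_h2 (\<lambda>y. lg13 (B y)) x ** lg12 (D x)"
      using eqs by (simp add: consistency_equations_def)
    then have DBB: "lg12 (D x) ** diag12 (\<lambda>i j. map_matrix r3 (\<beta> i x ** \<beta> j (translate \<gamma> x i))) =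
        diag12 (\<lambda>i j. map_matrix r3 (\<beta> j x ** \<beta> i (translate \<gamma> x j))) ** lg12 (D x)"
      by (simp add: diag diag_mult map_matrix_mult r3 flip: matrix_mul_assoc)
    \<comment> \<open>A nonzero \<open>d_ij\<close> may fail to be invertible as a series; it stays
      nonzero under the injective \<open>q12\<close> and is cancelled in an integral domain.\<close>
    have "q12 (D x $ (i, j) $ (i, j)) \<noteq> 0"
      using D[of x i j] inj_q12 zero by (metis inj_eq)
    then have "map_matrix r3 (\<beta> i x ** \<beta> j (translate \<gamma> x i)) = map_matrix r3 (\<beta> j x ** \<beta> i (translate \<gamma> x j))"
      using DBB[THEN arg_cong, of "\<lambda>M. M $ (i, j, _) $ (i, j, _)"]
      by (simp add: vec_eq_iff leg12_diag12_entries)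
    then show ?thesis
      by (simp add: map_matrix_eq_iff \<open>inj r3\<close>)
  qed
  obtain b :: "complex ^ 'n \<Rightarrow> ('a, 'n) op1" where b_inv: "\<And>x. invertible (b x)"
    and b: "\<And>x i. b (translate \<gamma> x i) = b x ** \<beta> i x"
    using flat_section[OF \<open>\<gamma> \<noteq> 0\<close> \<beta>_inv flat] by blast
  \<comment> \<open>On the \<open>k\<close>-th block of space 3, \<open>C_13\<close> and
    \<open>C_23\<close> become \<open>\<beta> k\<close> in spaces 1 and 2, and the shift by
    \<open>h_3\<close> moves A in direction \<open>k\<close>. The equation then involves
    \<open>u_1\<close> and \<open>u_2\<close> only, so the injective \<open>q12\<close> can be
    removed.\<close>
  have A_step: "A x ** (lg1 (\<beta> k x) ** lg2 (\<beta> k x)) = (lg1 (\<beta> k x) ** lg2 (\<beta> k x)) ** A (translate \<gamma> x k)" for x k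
  proof -
    have zero: "q13 0 = 0" "q23 0 = 0" "q12 0 = 0" "p1 0 = 0" "p2 0 = 0"
      using q13 q23 q12 p1 p2 by (simp_all add: ring_morphism_def)
    have diag: "lg12 (A x) = diag3 (\<lambda>k. map_matrix q12 (A x))"
      "lg13 (C x) = diag3 (\<lambda>k. map_matrix q12 (lg1 (\<beta> k x)))"
      "lg23 (C x) = diag3 (\<lambda>k. map_matrix q12 (lg2 (\<beta> k x)))"
      "dshift \<gamma> three_h3 (\<lambda>y. lg12 (A y)) x = diag3 (\<lambda>k. map_matrix q12 (A (translate \<gamma> x k)))"
      by (simp_all add: vec_eq_iff leg_entry C_entry diag_entry dshift_three_h3 q13_p1 q23_p1 zero)
    have "lg12 (A x) ** lg13 (C x) ** lg23 (C x) =
        lg23 (C x) ** lg13 (C x) ** dshift \<gamma> three_h3 (\<lambda>y. lg12 (A y)) x"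
      using eqs by (simp add: consistency_equations_def)
    then have "map_matrix q12 (A x ** lg1 (\<beta> k x) ** lg2 (\<beta> k x))
        = map_matrix q12 (lg2 (\<beta> k x) ** lg1 (\<beta> k x) ** A (translate \<gamma> x k))"
      by (simp add: diag diag_mult diag3_eq_iff map_matrix_mult q12)
    then show ?thesis
      by (simp add: map_matrix_eq_iff inj_q12 leg_commute(1) matrix_mul_assoc)
  qed
  define G where "G x = lg1 (b x) ** lg2 (b x)" for x
  define G' where "G' x = lg1 (matrix_inv (b x)) ** lg2 (matrix_inv (b x))" for x
  have G_mult: "lg1 X ** lg2 X ** (lg1 Y ** lg2 Y) = lg1 (X ** Y) ** lg2 (X ** Y)"
    for X Y :: "('a, 'n) op1"
  proof -
    have "lg1 X ** lg2 X ** (lg1 Y ** lg2 Y) = lg1 X ** (lg2 X ** lg1 Y) ** lg2 Y"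
      by (simp only: matrix_mul_assoc)
    then show ?thesis
      by (simp only: leg_commute(1) lg_mult matrix_mul_assoc)
  qed
  have G_inv: "G x ** G' x = mat 1" "G' x ** G x = mat 1" for x
    by (simp_all add: G_def G'_def G_mult matrix_inv_left matrix_inv_right b_inv lg_mat1)
  have G_step: "G (translate \<gamma> x i) = G x ** (lg1 (\<beta> i x) ** lg2 (\<beta> i x))" for x i
    by (simp only: G_def b G_mult)
  define R where "R x = G x ** A x ** G' x" for x
  have R_G: "R x ** G x = G x ** A x" for x
    by (simp add: R_def G_inv flip: matrix_mul_assoc)
  have "R (translate \<gamma> x i) = R x" for x i
  proof (rule matrix_mult_right_cancel)
    show "invertible (G (translate \<gamma> x i))"
      using G_inv invertible_def by blast
    \<comment> \<open>By \<open>R_G\<close> the left side is \<open>G\<close> times \<open>A\<close>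
      at the shifted point; \<open>G_step\<close> splits off the factors \<open>\<beta> i x\<close>,
      and \<open>A_step\<close> carries A past them back to \<open>x\<close>.\<close>
    have "R (translate \<gamma> x i) ** G (translate \<gamma> x i) = G x ** (A x ** (lg1 (\<beta> i x) ** lg2 (\<beta> i x)))"
      unfolding R_G A_step by (simp only: G_step matrix_mul_assoc)
    also have "\<dots> = R x ** G x ** (lg1 (\<beta> i x) ** lg2 (\<beta> i x))"
      by (simp only: R_G matrix_mul_assoc)
    finally show "R (translate \<gamma> x i) ** G (translate \<gamma> x i) = R x ** G (translate \<gamma> x i)"
      by (simp only: G_step matrix_mul_assoc)
  qed
  moreover have "yang_baxter lg12 lg13 lg23 (R x)" for x
    using yang_baxter_conjugate[of "A x" "b x" "R x"] eqs b_inv R_G[of x]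
    by (simp add: consistency_equations_def G_def)
  moreover have "A x = lg1 (matrix_inv (b x)) ** lg2 (matrix_inv (b x)) ** R x ** lg1 (b x) ** lg2 (b x)" for x
  proof -
    have "A x = G' x ** (R x ** G x)"
      by (simp add: R_G G_inv matrix_mul_assoc)
    then show ?thesis
      by (simp add: G_def G'_def matrix_mul_assoc)
  qed
  moreover have "B x = lg2 (matrix_inv (b x)) ** dshift \<gamma> two_h1 (\<lambda>y. lg2 (b y)) x" for x
  proof -
    have "p2 (\<beta> i x $ k $ l)
        = (\<Sum>c\<in>UNIV. p2 (matrix_inv (b x) $ k $ c) * p2 (b (translate \<gamma> x i) $ c $ l))" for i k l
      using map_matrix_mult[OF p2, of "matrix_inv (b x)" "b (translate \<gamma> x i)"]
      by (simp add: b matrix_mul_assoc matrix_inv_left b_inv matrix_mult_entry vec_eq_iff)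
    then show ?thesis
      by (simp add: vec_eq_iff B leg_entry matrix_mult_entry sum_UNIV_pair dshift_two_h1
          mult_if_zero sum_if_zero)
  qed
  moreover have "C x = lg1 (matrix_inv (b x)) ** dshift \<gamma> two_h2 (\<lambda>y. lg1 (b y)) x" for x
  proof -
    have "p1 (\<beta> i x $ k $ l)
        = (\<Sum>c\<in>UNIV. p1 (matrix_inv (b x) $ k $ c) * p1 (b (translate \<gamma> x i) $ c $ l))" for i k l
      using map_matrix_mult[OF p1, of "matrix_inv (b x)" "b (translate \<gamma> x i)"]
      by (simp add: b matrix_mul_assoc matrix_inv_left b_inv matrix_mult_entry vec_eq_iff)
    then show ?thesis
      by (simp add: vec_eq_iff C_entry leg_entry matrix_mult_entry sum_UNIV_pair dshift_two_h2
          mult_if_zero sum_if_zero)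
  qed
  ultimately show ?thesis
    using b_inv by blast
qed

end

section \<open>The spectral and scalar instances of the common setting\<close>

lemma fps_map_nth: "fps_nth (fps_map f F) m = f (fps_nth F m)"
  by (simp add: fps_map_def)

lemma ring_morphism_fps_map: "ring_morphism f \<Longrightarrow> ring_morphism (fps_map f)"
  by (simp add: ring_morphism_def fps_eq_iff fps_map_nth fps_mult_nth
      ring_morphism_sum[unfolded ring_morphism_def])

lemma ring_morphism_fps_const: "ring_morphism fps_const"
  by (simp add: ring_morphism_def fps_const_1_eq_1)

lemma ring_morphism_fps_nth_0: "ring_morphism (\<lambda>F. fps_nth F 0)"
  by (simp add: ring_morphism_def fps_mult_nth_0)

lemma inj_fps_map: "inj f \<Longrightarrow> inj (fps_map f)"
  by (simp add: inj_def fps_eq_iff fps_map_nth)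

lemma inj_fps_const: "inj fps_const"
  by (simp add: inj_def)

text \<open>The outermost variable is \<open>u_2\<close>, so setting \<open>u_1 = 0\<close> means
  taking the constant term of every coefficient.\<close>

interpretation series: parameter_maps ser1 ser2 ser21 "fps_map (\<lambda>F. fps_nth F 0)" ser12 ser13 ser23
proof -
  have eta: "ser1 = fps_const" "ser2 = fps_map fps_const" "ser12 = fps_const"
    "ser13 = fps_map fps_const" "ser23 = fps_map (fps_map fps_const)"
    by (simp_all add: fun_eq_iff ser1_def ser2_def ser12_def ser13_def ser23_def)
  show "parameter_maps ser1 ser2 ser21 (fps_map (\<lambda>F. fps_nth F 0)) ser12 ser13 ser23"
    by unfold_locales
      (simp_all add: eta ser21_def ring_morphism_fps_map ring_morphism_fps_const ring_morphism_fps_nth_0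
        inj_fps_map inj_fps_const, simp_all add: fps_eq_iff fps_map_nth)
qed

interpretation scalar: parameter_maps "\<lambda>z :: complex. z" "\<lambda>z. z" "\<lambda>z. z" "\<lambda>z. z" "\<lambda>z. z" "\<lambda>z. z" "\<lambda>z. z"
  by unfold_locales (simp_all add: ring_morphism_def)

lemma two_h1_mult_entry:
  fixes M :: "('a::comm_ring_1, 'n::finite) op2"
  shows "(two_h1 k ** M) $ (i, j) $ q = (if k = i then M $ (i, j) $ q else 0)"
proof -
  have "(two_h1 k :: ('a, 'n) op2) $ (i, j) $ r = (if (i, j) = r then if k = i then 1 else 0 else 0)" for r
    by (auto simp: two_h1_diagonal)
  then show ?thesis
    by (simp add: matrix_mult_entry mult_delta_left)
qed

text \<open>At this entry \<open>two_h1 i ** B x\<close> keeps row \<open>i\<close> while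
  \<open>B x ** two_h1 i\<close> kills column \<open>i'\<close>, so the vanishing commutator has the
  entry of \<open>B x\<close> itself.\<close>

lemma zero_weight_imp_diagonal:
  assumes "zero_weight B C D" and "i \<noteq> i'"
  shows "B x $ (i, j) $ (i', j') = 0"
proof -
  have "(two_h1 i ** B x - B x ** two_h1 i) $ (i, j) $ (i', j') = 0"
    using assms(1) by (simp add: zero_weight_def commutator_def)
  moreover have "(B x ** two_h1 i) $ (i, j) $ (i', j') = 0"
    using \<open>i \<noteq> i'\<close> by (simp add: two_h1_diagonal matrix_mult_entry)
  ultimately show ?thesis
    by (simp add: two_h1_mult_entry)
qed

theorem mainTheorem1:
  fixes \<gamma> :: complex
  assumes "\<gamma> \<noteq> 0"
  shows
    "(\<forall>(A :: complex ^ 'n::finite \<Rightarrow> (complex, 'n) op2) B C D.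
        zero_weight B C D \<longrightarrow>
        (\<forall>x. C x = leg21 (B x)) \<longrightarrow>
        consistency_equations \<gamma> leg12 leg13 leg23 A B C D \<longrightarrow>
        (\<forall>x i j. D x $ (i, j) $ (i, j) \<noteq> 0) \<longrightarrow>
        (\<forall>x. invertible (B x)) \<longrightarrow>
        (\<exists>(b :: complex ^ 'n \<Rightarrow> (complex, 'n) op1) (R :: complex ^ 'n \<Rightarrow> (complex, 'n) op2).
           (\<forall>x. invertible (b x)) \<and>
           (\<forall>x. A x = leg1 (matrix_inv (b x)) ** leg2 (matrix_inv (b x)) ** R x **
                        leg1 (b x) ** leg2 (b x)) \<and>
           (\<forall>x. B x = leg2 (matrix_inv (b x)) ** dshift \<gamma> two_h1 (\<lambda>y. leg2 (b y)) x) \<and>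
           (\<forall>x. C x = leg1 (matrix_inv (b x)) ** dshift \<gamma> two_h2 (\<lambda>y. leg1 (b y)) x) \<and>
           (\<forall>x i. R (translate \<gamma> x i) = R x) \<and>
           (\<forall>x. yang_baxter leg12 leg13 leg23 (R x))))
     \<and>
     (\<forall>(A :: complex ^ 'n \<Rightarrow> (complex fps fps, 'n) op2) B C D.
        (\<exists>\<beta> :: 'n \<Rightarrow> complex ^ 'n \<Rightarrow> (complex fps, 'n) op1.
           \<forall>x. B x = (\<Sum>i\<in>UNIV. two_h1 i ** sleg2 (\<beta> i x))) \<longrightarrow>
        zero_weight B C D \<longrightarrow>
        (\<forall>x. C x = sleg21 (B x)) \<longrightarrow>
        consistency_equations \<gamma> sleg12 sleg13 sleg23 A B C D \<longrightarrow>
        (\<forall>x i j. D x $ (i, j) $ (i, j) \<noteq> 0) \<longrightarrow>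
        (\<forall>x. invertible (B x)) \<longrightarrow>
        (\<exists>(b :: complex ^ 'n \<Rightarrow> (complex fps, 'n) op1) (R :: complex ^ 'n \<Rightarrow> (complex fps fps, 'n) op2).
           (\<forall>x. invertible (b x)) \<and>
           (\<forall>x. A x = sleg1 (matrix_inv (b x)) ** sleg2 (matrix_inv (b x)) ** R x **
                        sleg1 (b x) ** sleg2 (b x)) \<and>
           (\<forall>x. B x = sleg2 (matrix_inv (b x)) ** dshift \<gamma> two_h1 (\<lambda>y. sleg2 (b y)) x) \<and>
           (\<forall>x. C x = sleg1 (matrix_inv (b x)) ** dshift \<gamma> two_h2 (\<lambda>y. sleg1 (b y)) x) \<and>
           (\<forall>x i. R (translate \<gamma> x i) = R x) \<and>
           (\<forall>x. yang_baxter sleg12 sleg13 sleg23 (R x))))"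
proof (intro conjI allI impI, goal_cases)
  case (1 A B C D)
  define \<beta> where "\<beta> i x = (\<chi> j l. B x $ (i, j) $ (i, l))" for i x
  have id: "map_matrix (\<lambda>z. z) M = M" for M :: "complex ^ 'k ^ 'l"
    by (simp add: vec_eq_iff)
  have B: "B x $ (i, j) $ (i', j') = (if i = i' then \<beta> i x $ j $ j' else 0)" for x i j i' j'
    using zero_weight_imp_diagonal[OF 1(1)] by (simp add: \<beta>_def)
  show ?case
    by (rule scalar.vertex_form[OF assms, unfolded id, OF B]) (use 1 in blast)+
next
  case (2 A B C D)
  then obtain \<beta> where "B x = (\<Sum>i\<in>UNIV. two_h1 i ** sleg2 (\<beta> i x))" for x
    by blast
  \<comment> \<open>The given expansion supplies blocks that are series in \<open>u_2\<close> alone,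
    which zero weight by itself would not.\<close>
  then have B: "B x $ (i, j) $ (i', j') = (if i = i' then ser2 (\<beta> i x $ j $ j') else 0)" for x i j i' j'
    by (simp add: sleg2_def two_h1_mult_entry leg_entry)
  have sleg: "sleg1 = series.lg1" "sleg2 = series.lg2"
    "sleg12 = series.lg12" "sleg13 = series.lg13" "sleg23 = series.lg23"
    by (simp_all add: fun_eq_iff sleg1_def sleg2_def sleg12_def sleg13_def sleg23_def)
  have C: "C x = leg21 (map_matrix ser21 (B x))" for x
    using 2 by (simp add: sleg21_def)
  show ?case
    unfolding sleg by (rule series.vertex_form[OF assms B C]) (use 2 in \<open>unfold sleg, blast\<close>)+
qed

end
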